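(* Let $m\ge 1$, let $(p_i(n))_{n\ge 0}$, $1\le i\le m$, be sequences of nonnegative real numbers with $\sum_{i=1}^m p_i(n)<1$ for all $n\ge 0$, and let $(\tau_i(n))_{n\ge 0}$, $1\le i\le m$, be sequences of integers such that $\tau_i(n)\le n-1$ for all $n\ge 0$ and $\lim_{n\to\infty}\tau_i(n)=\infty$, $1\le i\le m$. Let $\varphi_i(n)=\max_{0\le s\le n}\tau_i(s)$ and $\varphi(n)=\max_{1\le i\le m}\varphi_i(n)$ for $n\ge 0$, and let $$\alpha=\min_{1\le i\le m}\alpha_i,\qquad \alpha_i=\liminf_{n\to\infty}\sum_{j=\varphi_i(n)}^{n-1}p_i(j).$$ Let $a_r(n,k)$ be defined by $$a_1(n,k)=\prod_{i=k}^{n-1}\Big[1-\sum_{\ell=1}^m p_\ell(i)\Big],\qquad a_{r+1}(n,k)=\prod_{i=k}^{n-1}\Big[1-\sum_{\ell=1}^m p_\ell(i)\,a_r^{-1}(i,\tau_\ell(i))\Big],\quad r\in\mathbb{N}.$$ If $0<\alpha\le 1/e$ and for some $r\in\mathbb{N}$ $$\limsup_{n\to\infty}\sum_{j=\varphi(n)}^{n}\sum_{i=1}^{m}p_i(j)\,a_r^{-1}(\varphi(n),\tau_i(j))>1-\frac{1-\alpha-\sqrt{1-2\alpha-\alpha^2}}{2},$$ then all solutions of the difference equation $$\Delta x(n)+\sum_{i=1}^m p_i(n)\,x(\tau_i(n))=0,\qquad n\ge 0,$$ oscillate.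
   Context: $\mathbb{N}=\{1,2,\dots\}$. $\Delta x(n)=x(n+1)-x(n)$. Let $w=-\min_{n\ge0,\,1\le i\le m}\tau_i(n)$ (a finite positive integer). A solution of the equation is a real sequence $(x(n))_{n\ge -w}$ satisfying the equation for all $n\ge 0$. A solution is oscillatory (oscillates) if it is neither eventually positive nor eventually negative. Empty products equal $1$, and $a_r^{-1}(n,k)$ means $1/a_r(n,k)$. For fixed $r$, only values of $a_r(n,k)$ with large $n,k$ matter for the limsup, since $\tau_i(n)\to\infty$; then all indices occurring are nonnegative. *)

theory Defs
  imports Complex_Main "HOL-Library.Extended_Real"
begin

text \<open>
  The data are \<open>p i n\<close> and \<open>\<tau> i n\<close> for \<open>i \<in> {1..m}\<close> and \<open>n :: nat\<close>; the values of \<open>\<tau>\<close> are integers,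
  negative ones included. The sequences \<open>p i\<close> have no terms at negative indices. Where an index
  range written in the mathematics reaches below 0 (possible only for small indices), it is
  cut off at 0 with \<open>nat\<close>, i.e. terms with a negative index count as 0 in sums and as 1 in
  products.
\<close>

definition \<phi>i :: "(nat \<Rightarrow> nat \<Rightarrow> int) \<Rightarrow> nat \<Rightarrow> nat \<Rightarrow> int" where
  "\<phi>i \<tau> i n = (MAX s\<in>{0..n}. \<tau> i s)"

definition \<phi> :: "nat \<Rightarrow> (nat \<Rightarrow> nat \<Rightarrow> int) \<Rightarrow> nat \<Rightarrow> int" where
  "\<phi> m \<tau> n = (MAX i\<in>{1..m}. \<phi>i \<tau> i n)"

text \<open>The lower and upper limits are taken in the extended reals, since the sums need not be
  bounded.\<close>

definition \<alpha>i :: "(nat \<Rightarrow> nat \<Rightarrow> real) \<Rightarrow> (nat \<Rightarrow> nat \<Rightarrow> int) \<Rightarrow> nat \<Rightarrow> ereal" where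
  "\<alpha>i p \<tau> i = liminf (\<lambda>n. ereal (\<Sum>j\<in>{nat (\<phi>i \<tau> i n)..<n}. p i j))"

definition min_\<alpha>i :: "nat \<Rightarrow> (nat \<Rightarrow> nat \<Rightarrow> real) \<Rightarrow> (nat \<Rightarrow> nat \<Rightarrow> int) \<Rightarrow> ereal" where
  "min_\<alpha>i m p \<tau> = (MIN i\<in>{1..m}. \<alpha>i p \<tau> i)"

text \<open>\<open>a_seq m p \<tau> r n k\<close> is \<open>a\<^sub>r(n,k)\<close>; only \<open>r \<ge> 1\<close> is meaningful, and the clause for \<open>r = 0\<close> is a
  dummy that the others never use. No positivity of the factors is assumed; as soon as an eventually
  positive or eventually negative solution exists, \<open>a\<^sub>r(n,k) > 0\<close> for all large \<open>n\<close>, \<open>k\<close>, so the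
  convention \<open>inverse 0 = 0\<close> has no effect on the oscillation criterion.\<close>

fun a_seq :: "nat \<Rightarrow> (nat \<Rightarrow> nat \<Rightarrow> real) \<Rightarrow> (nat \<Rightarrow> nat \<Rightarrow> int) \<Rightarrow> nat \<Rightarrow> int \<Rightarrow> int \<Rightarrow> real" where
  "a_seq m p \<tau> 0 n k = 1"
| "a_seq m p \<tau> (Suc 0) n k = (\<Prod>i\<in>{nat k..<nat n}. 1 - (\<Sum>l=1..m. p l i))"
| "a_seq m p \<tau> (Suc (Suc r)) n k =
     (\<Prod>i\<in>{nat k..<nat n}. 1 - (\<Sum>l=1..m. p l i * inverse (a_seq m p \<tau> (Suc r) (int i) (\<tau> l i))))"

definition \<Delta> :: "(int \<Rightarrow> real) \<Rightarrow> int \<Rightarrow> real" where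
  "\<Delta> x n = x (n + 1) - x n"

text \<open>A solution is a sequence on \<open>{-w..}\<close> with \<open>-w\<close> the least value of all the \<open>\<tau> i\<close>. It is
  represented by a function on all integers: the equation never refers to values below \<open>-w\<close>, and
  those values are irrelevant for oscillation.\<close>

definition is_solution ::
    "nat \<Rightarrow> (nat \<Rightarrow> nat \<Rightarrow> real) \<Rightarrow> (nat \<Rightarrow> nat \<Rightarrow> int) \<Rightarrow> (int \<Rightarrow> real) \<Rightarrow> bool" where
  "is_solution m p \<tau> x \<longleftrightarrow> (\<forall>n::nat. \<Delta> x (int n) + (\<Sum>i=1..m. p i n * x (\<tau> i n)) = 0)"

definition oscillatory :: "(int \<Rightarrow> real) \<Rightarrow> bool" where
  "oscillatory x \<longleftrightarrow>
     \<not> (\<forall>\<^sub>F n in at_top. x n > 0) \<and> \<not> (\<forall>\<^sub>F n in at_top. x n < 0)"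

end

theory Submission
  imports Defs
begin

text \<open>
  An eventually positive solution is eventually nonincreasing, and a discrete Gronwall argument
  gives \<open>x(n) \<le> a\<^sub>r(n,k) x(k)\<close>. Summing the equation from \<open>\<phi>(n)\<close> to \<open>n\<close> then bounds the sum in
  the criterion by \<open>1 - x(n+1) / x(\<phi>(n))\<close>. As \<open>\<phi>\<^sub>i \<le> \<phi>\<close>,
  it remains to see that \<open>d = liminf x(n+1) / x(\<phi>\<^sub>i(n))\<close> is at least
  \<open>D = (1 - \<alpha> - sqrt (1 - 2\<alpha> - \<alpha>\<^sup>2)) / 2\<close> for one \<open>i\<close>. Applying the single-delay inequality
  \<open>\<Delta>x(n) + p\<^sub>i(n) x(\<phi>\<^sub>i(n)) \<le> 0\<close> twice over windows of mass \<open>\<alpha>\<close> yields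
  \<open>d (1 - \<alpha> - d) \<ge> \<alpha>\<^sup>2 / 2\<close>, and \<open>D\<close> is the smaller root of the corresponding quadratic.
\<close>

section \<open>Elementary estimates for finite sums\<close>

text \<open>Discrete form of integrating \<open>F * F'\<close>: expanding the square of the total
  leaves, besides the left side, only half the sum of the squares of the \<open>p j\<close>.\<close>

lemma sum_mult_partial_sum_le:
  fixes p :: "nat \<Rightarrow> real"
  assumes "a \<le> k" "\<And>j. j \<ge> a \<Longrightarrow> 0 \<le> p j"
  shows "(\<Sum>j\<in>{a..<k}. p j * (\<Sum>v\<in>{a..<j}. p v)) \<le> (\<Sum>j\<in>{a..<k}. p j)\<^sup>2 / 2"
  using assms(1)
proof (induction k rule: dec_induct)
  case (step k)
  let ?S = "\<Sum>j\<in>{a..<k}. p j"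
  have "(?S + p k)\<^sup>2 / 2 = ?S\<^sup>2 / 2 + p k * ?S + (p k)\<^sup>2 / 2"
    by (simp add: power2_eq_square field_simps)
  moreover have "0 \<le> (p k)\<^sup>2 / 2" by simp
  ultimately have "?S\<^sup>2 / 2 + p k * ?S \<le> (?S + p k)\<^sup>2 / 2" by linarith
  then show ?case using step.IH step.hyps by simp
qed simp

text \<open>A left Riemann sum of the decreasing function \<open>\<beta> - t\<close> on \<open>[0, \<beta>]\<close>; the last, possibly
  overshooting, weight \<open>p s\<close> only helps.\<close>

lemma left_riemann_sum_ge:
  fixes p :: "nat \<Rightarrow> real"
  assumes "a \<le> s" "\<And>j. j \<ge> a \<Longrightarrow> 0 \<le> p j"
    and lt: "(\<Sum>j\<in>{a..<s}. p j) \<le> \<beta>" and ge: "\<beta> \<le> (\<Sum>j\<in>{a..<Suc s}. p j)"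
  shows "\<beta>\<^sup>2 / 2 \<le> (\<Sum>j\<in>{a..<Suc s}. p j * (\<beta> - (\<Sum>v\<in>{a..<j}. p v)))"
proof -
  let ?S = "\<Sum>j\<in>{a..<s}. p j"
  have "(\<Sum>j\<in>{a..<s}. p j * (\<beta> - (\<Sum>v\<in>{a..<j}. p v)))
      = \<beta> * ?S - (\<Sum>j\<in>{a..<s}. p j * (\<Sum>v\<in>{a..<j}. p v))"
    by (simp add: right_diff_distrib sum_subtractf sum_distrib_left mult.commute)
  moreover have "(\<beta> - ?S) * (\<beta> - ?S) \<le> p s * (\<beta> - ?S)"
    using lt ge assms(1) by (intro mult_right_mono) auto
  moreover have "0 \<le> (\<beta> - ?S)\<^sup>2" by simp
  moreover have "\<beta>\<^sup>2 / 2 + (\<beta> - ?S)\<^sup>2 / 2 = \<beta> * ?S - ?S\<^sup>2 / 2 + (\<beta> - ?S) * (\<beta> - ?S)"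
    by (simp add: power2_eq_square field_simps)
  moreover have "(\<Sum>j\<in>{a..<s}. p j * (\<Sum>v\<in>{a..<j}. p v)) \<le> ?S\<^sup>2 / 2"
    by (rule sum_mult_partial_sum_le) (use assms in auto)
  ultimately have "\<beta>\<^sup>2 / 2 \<le> (\<Sum>j\<in>{a..<s}. p j * (\<beta> - (\<Sum>v\<in>{a..<j}. p v))) + p s * (\<beta> - ?S)"
    by linarith
  then show ?thesis using assms(1) by simp
qed

lemma sum_decrements:
  fixes y :: "nat \<Rightarrow> real"
  assumes "a \<le> b" "\<And>n. a \<le> n \<Longrightarrow> n < b \<Longrightarrow> f n \<le> y n - y (Suc n)"
  shows "(\<Sum>j\<in>{a..<b}. f j) \<le> y a - y b"
proof -
  have "(\<Sum>j\<in>{a..<b}. f j) \<le> (\<Sum>j\<in>{a..<b}. y j - y (Suc j))"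
    using assms(2) by (intro sum_mono) auto
  also have "\<dots> = y a - y b"
    using assms(1) by (induction b rule: dec_induct) auto
  finally show ?thesis .
qed

section \<open>The ratio \<open>y (Suc n) / y (\<sigma> n)\<close> for a single delay\<close>

text \<open>Turns a lower bound \<open>d\<close> for the ratio into a new one. The inequality is
  summed over a stretch after \<open>n\<close> of mass about \<open>\<beta>\<close>, and each
  delayed value there is bounded below by a second summation, back across \<open>n\<close>.\<close>

lemma delay_ratio_improve:
  fixes y p :: "nat \<Rightarrow> real" and \<sigma> :: "nat \<Rightarrow> nat"
  assumes p: "\<And>n. N \<le> n \<Longrightarrow> 0 \<le> p n"
    and pos: "\<And>n. N \<le> n \<Longrightarrow> 0 < y n"
    and antimono: "\<And>k n. N \<le> k \<Longrightarrow> k \<le> n \<Longrightarrow> y n \<le> y k"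
    and ineq: "\<And>n. N \<le> n \<Longrightarrow> y (Suc n) \<le> y n - p n * y (\<sigma> n)"
    and "mono \<sigma>" "filterlim \<sigma> at_top sequentially"
    and window: "\<And>n. N \<le> n \<Longrightarrow> \<beta> \<le> (\<Sum>j\<in>{\<sigma> n..<n}. p j)"
    and "0 < \<beta>" "0 \<le> d"
    and ratio: "\<And>n. N \<le> n \<Longrightarrow> d * y (\<sigma> n) \<le> y (Suc n)"
    and n: "N \<le> n" "N \<le> \<sigma> n" "N \<le> \<sigma> (\<sigma> n)"
  shows "\<beta>\<^sup>2 / 2 * y (\<sigma> n) \<le> (1 - \<beta> - d) * y (Suc n)"
proof -
  let ?P = "\<lambda>k. \<beta> \<le> (\<Sum>j\<in>{Suc n..<k}. p j)"
  have "eventually (\<lambda>k. Suc n \<le> \<sigma> k \<and> N \<le> k) sequentially"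
    using assms(6) by (auto simp: filterlim_at_top intro: eventually_conj eventually_ge_at_top)
  then obtain k0 where k0: "Suc n \<le> \<sigma> k0" "N \<le> k0"
    by (auto simp: eventually_sequentially)
  have "(\<Sum>j\<in>{\<sigma> k0..<k0}. p j) \<le> (\<Sum>j\<in>{Suc n..<k0}. p j)"
    using k0(1) n(1) by (intro sum_mono2) (auto intro!: p)
  then have "?P k0" using window[OF k0(2)] by simp
  \<comment> \<open>The stretch after \<open>n\<close> ends as soon as its mass reaches
    \<open>\<beta>\<close>. With \<open>k = Suc s\<close>, the index \<open>s\<close> is the one
    whose weight crosses that level.\<close>
  define k where "k = (LEAST k. ?P k)"
  have Pk: "?P k" unfolding k_def by (rule LeastI) fact
  have "Suc n < k"
    using Pk \<open>0 < \<beta>\<close> by (rule_tac ccontr) simp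
  then obtain s where s: "k = Suc s" "Suc n \<le> s" by (cases k) auto
  have lt: "(\<Sum>j\<in>{Suc n..<s}. p j) < \<beta>"
    using not_less_Least[of s ?P] s(1) unfolding k_def by (auto simp: not_le)
  have ge: "\<beta> \<le> (\<Sum>j\<in>{Suc n..<Suc s}. p j)" using Pk s by simp
  \<comment> \<open>Otherwise the whole window of \<open>s\<close> would lie after \<open>n\<close>,
    where the mass up to \<open>s\<close> is still below \<open>\<beta>\<close>.\<close>
  have "\<sigma> s \<le> n"
  proof (rule ccontr)
    assume "\<not> \<sigma> s \<le> n"
    then have "(\<Sum>j\<in>{\<sigma> s..<s}. p j) \<le> (\<Sum>j\<in>{Suc n..<s}. p j)"
      using n(1) by (intro sum_mono2) (auto intro!: p)
    with lt window[of s] s n(1) show False by simp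
  qed
  \<comment> \<open>The window of \<open>j\<close> is cut at \<open>Suc n\<close>: what its later
    part lacks of mass \<open>\<beta>\<close> lies before the cut, where each decrement is at least
    \<open>p v * y (\<sigma> n)\<close> because \<open>\<sigma> v \<le> \<sigma> n\<close>.\<close>
  have first: "y (Suc n) + y (\<sigma> n) * (\<beta> - (\<Sum>v\<in>{Suc n..<j}. p v)) \<le> y (\<sigma> j)"
    if j: "Suc n \<le> j" "j \<le> s" for j
  proof -
    have sj: "\<sigma> j \<le> n" "\<sigma> n \<le> \<sigma> j"
      using monoD[OF \<open>mono \<sigma>\<close>, of j s] monoD[OF \<open>mono \<sigma>\<close>, of n j] j \<open>\<sigma> s \<le> n\<close> by auto
    have "\<beta> \<le> (\<Sum>v\<in>{\<sigma> j..<j}. p v)" using window j n by simp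
    also have "\<dots> = (\<Sum>v\<in>{\<sigma> j..<Suc n}. p v) + (\<Sum>v\<in>{Suc n..<j}. p v)"
      using sj j by (intro sum.atLeastLessThan_concat[symmetric]) auto
    finally have "y (\<sigma> n) * (\<beta> - (\<Sum>v\<in>{Suc n..<j}. p v)) \<le> y (\<sigma> n) * (\<Sum>v\<in>{\<sigma> j..<Suc n}. p v)"
      using pos[of "\<sigma> n"] n by (intro mult_left_mono) auto
    also have "\<dots> \<le> y (\<sigma> j) - y (Suc n)"
      unfolding sum_distrib_left
    proof (rule sum_decrements)
      fix v assume v: "\<sigma> j \<le> v" "v < Suc n"
      then have vN: "N \<le> v" using n sj by simp
      have "\<sigma> (\<sigma> n) \<le> \<sigma> v" "\<sigma> v \<le> \<sigma> n"
        using monoD[OF \<open>mono \<sigma>\<close>, of "\<sigma> n" v] monoD[OF \<open>mono \<sigma>\<close>, of v n] v sj by auto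
      then have "y (\<sigma> n) \<le> y (\<sigma> v)" using antimono n by simp
      then have "y (\<sigma> n) * p v \<le> p v * y (\<sigma> v)"
        using p[OF vN] by (simp add: mult.commute mult_left_mono)
      then show "y (\<sigma> n) * p v \<le> y v - y (Suc v)" using ineq[OF vN] by simp
    qed (use sj in simp)
    finally show ?thesis by simp
  qed
  have "\<beta>\<^sup>2 / 2 * y (\<sigma> n)
      \<le> (\<Sum>j\<in>{Suc n..<Suc s}. p j * (\<beta> - (\<Sum>v\<in>{Suc n..<j}. p v))) * y (\<sigma> n)"
    using left_riemann_sum_ge[of "Suc n" s p \<beta>] s n lt ge p pos[of "\<sigma> n"]
    by (intro mult_right_mono) auto
  moreover have "\<beta> * y (Suc n) \<le> (\<Sum>j\<in>{Suc n..<Suc s}. p j) * y (Suc n)"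
    using ge pos[of "Suc n"] n by (intro mult_right_mono) auto
  moreover have "(\<Sum>j\<in>{Suc n..<Suc s}. p j) * y (Suc n)
        + (\<Sum>j\<in>{Suc n..<Suc s}. p j * (\<beta> - (\<Sum>v\<in>{Suc n..<j}. p v))) * y (\<sigma> n)
      = (\<Sum>j\<in>{Suc n..<Suc s}. p j * (y (Suc n) + y (\<sigma> n) * (\<beta> - (\<Sum>v\<in>{Suc n..<j}. p v))))"
    unfolding sum_distrib_right sum.distrib[symmetric]
    by (intro sum.cong) (auto simp: algebra_simps)
  moreover have "\<dots> \<le> y (Suc n) - y (Suc s)"
  proof (rule sum_decrements)
    fix j assume j: "Suc n \<le> j" "j < Suc s"
    then have "p j * (y (Suc n) + y (\<sigma> n) * (\<beta> - (\<Sum>v\<in>{Suc n..<j}. p v))) \<le> p j * y (\<sigma> j)"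
      using first p n by (intro mult_left_mono) auto
    then show "p j * (y (Suc n) + y (\<sigma> n) * (\<beta> - (\<Sum>v\<in>{Suc n..<j}. p v))) \<le> y j - y (Suc j)"
      using ineq[of j] j n by simp
  qed (use s in simp)
  \<comment> \<open>The old bound enters here: the end value \<open>y (Suc s)\<close> is not merely
    positive but at least a \<open>d\<close>-th part of \<open>y (\<sigma> s)\<close>.\<close>
  moreover have "d * y (Suc n) \<le> y (Suc s)"
  proof -
    have "\<sigma> n \<le> \<sigma> s" using monoD[OF \<open>mono \<sigma>\<close>, of n s] s by simp
    then have "y (Suc n) \<le> y (\<sigma> s)" using antimono n \<open>\<sigma> s \<le> n\<close> by simp
    then have "d * y (Suc n) \<le> d * y (\<sigma> s)" using \<open>0 \<le> d\<close> by (rule mult_left_mono)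
    also have "\<dots> \<le> y (Suc s)" using ratio s n by simp
    finally show ?thesis .
  qed
  ultimately show ?thesis by (simp add: algebra_simps)
qed

text \<open>Completing the square; the hypothesis itself makes the discriminant nonnegative.\<close>

lemma smaller_root_le:
  fixes d \<alpha> :: real
  assumes "\<alpha>\<^sup>2 / 2 \<le> d * (1 - \<alpha> - d)"
  shows "(1 - \<alpha> - sqrt (1 - 2 * \<alpha> - \<alpha>\<^sup>2)) / 2 \<le> d"
proof -
  have "(1 - \<alpha> - 2 * d)\<^sup>2 \<le> 1 - 2 * \<alpha> - \<alpha>\<^sup>2"
    using assms by (simp add: power2_eq_square algebra_simps)
  then have "1 - \<alpha> - 2 * d \<le> sqrt (1 - 2 * \<alpha> - \<alpha>\<^sup>2)"
    by (rule real_le_rsqrt)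
  then show ?thesis by simp
qed

text \<open>The supremum \<open>e\<close> of the set \<open>S\<close> of eventual lower bounds is
  the lower limit of the ratio. Since the improvement step maps nonnegative members of
  \<open>S\<close> into \<open>S\<close>, \<open>e\<close> satisfies the quadratic
  inequality.\<close>

lemma delay_ratio_lower_bound:
  fixes y p :: "nat \<Rightarrow> real" and \<sigma> :: "nat \<Rightarrow> nat"
  assumes p: "\<And>n. 0 \<le> p n"
    and pos: "eventually (\<lambda>n. 0 < y n) sequentially"
    and ineq: "eventually (\<lambda>n. y (Suc n) \<le> y n - p n * y (\<sigma> n)) sequentially"
    and "mono \<sigma>" and lim: "filterlim \<sigma> at_top sequentially"
    and window: "\<And>\<beta>. \<beta> < \<alpha> \<Longrightarrow> eventually (\<lambda>n. \<beta> \<le> (\<Sum>j\<in>{\<sigma> n..<n}. p j)) sequentially"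
    and "0 < \<alpha>"
    and d: "d < (1 - \<alpha> - sqrt (1 - 2 * \<alpha> - \<alpha>\<^sup>2)) / 2"
  shows "eventually (\<lambda>n. d * y (\<sigma> n) \<le> y (Suc n)) sequentially"
proof -
  define S where "S = {d. eventually (\<lambda>n. d * y (\<sigma> n) \<le> y (Suc n)) sequentially}"
  have pos\<sigma>: "eventually (\<lambda>n. 0 < y (\<sigma> n)) sequentially"
    by (rule eventually_compose_filterlim[OF pos lim])
  have "eventually (\<lambda>n. 0 < y n \<and> 0 < y (\<sigma> n) \<and> y (Suc n) \<le> y n - p n * y (\<sigma> n)) sequentially"
    using pos pos\<sigma> ineq by (intro eventually_conj)
  then obtain N where N: "\<And>n. N \<le> n \<Longrightarrow> 0 < y n" "\<And>n. N \<le> n \<Longrightarrow> 0 < y (\<sigma> n)"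
    "\<And>n. N \<le> n \<Longrightarrow> y (Suc n) \<le> y n - p n * y (\<sigma> n)"
    unfolding eventually_sequentially by auto
  have antimono: "y n \<le> y k" if "N \<le> k" "k \<le> n" for k n
    using that(2)
  proof (induction n rule: dec_induct)
    case (step n)
    then have "0 \<le> p n * y (\<sigma> n)" using p[of n] N(2)[of n] that(1) by simp
    then show ?case using N(3)[of n] step that(1) by simp
  qed simp
  have zero: "0 \<in> S"
    unfolding S_def using N(1) by (auto simp: eventually_sequentially intro!: exI[of _ N] less_imp_le)
  \<comment> \<open>The sign of \<open>1 - \<beta> - d\<close> is read off from the improved
    inequality, whose left side is positive.\<close>
  have improve: "\<beta>\<^sup>2 / 2 / (1 - \<beta> - d) \<in> S \<and> 0 < 1 - \<beta> - d"
    if d: "d \<in> S" "0 \<le> d" and \<beta>: "0 < \<beta>" "\<beta> < \<alpha>" for d \<beta>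
  proof -
    have "eventually (\<lambda>n. \<beta> \<le> (\<Sum>j\<in>{\<sigma> n..<n}. p j) \<and> d * y (\<sigma> n) \<le> y (Suc n)) sequentially"
      using window[OF \<beta>(2)] d(1) unfolding S_def by (auto intro: eventually_conj)
    then obtain M0 where M0: "\<And>n. M0 \<le> n \<Longrightarrow> \<beta> \<le> (\<Sum>j\<in>{\<sigma> n..<n}. p j)"
      "\<And>n. M0 \<le> n \<Longrightarrow> d * y (\<sigma> n) \<le> y (Suc n)"
      unfolding eventually_sequentially by auto
    define M where "M = max M0 N"
    have ev\<sigma>: "eventually (\<lambda>n. M \<le> \<sigma> n) sequentially"
      using lim by (simp add: filterlim_at_top)
    have ev\<sigma>\<sigma>: "eventually (\<lambda>n. M \<le> \<sigma> (\<sigma> n)) sequentially"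
      by (rule eventually_compose_filterlim[OF ev\<sigma> lim])
    have ev: "eventually (\<lambda>n. M \<le> n \<and> M \<le> \<sigma> n \<and> M \<le> \<sigma> (\<sigma> n)) sequentially"
      by (intro eventually_conj eventually_ge_at_top ev\<sigma> ev\<sigma>\<sigma>)
    have *: "\<beta>\<^sup>2 / 2 * y (\<sigma> n) \<le> (1 - \<beta> - d) * y (Suc n)"
      if "M \<le> n \<and> M \<le> \<sigma> n \<and> M \<le> \<sigma> (\<sigma> n)" for n
      using that p N(1,3) antimono M0 \<open>mono \<sigma>\<close> lim \<beta>(1) d(2)
      by (intro delay_ratio_improve[where N = M and p = p]) (auto simp: M_def)
    obtain n where n: "M \<le> n \<and> M \<le> \<sigma> n \<and> M \<le> \<sigma> (\<sigma> n)"
      using ev unfolding eventually_sequentially by auto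
    then have "0 < \<beta>\<^sup>2 / 2 * y (\<sigma> n)" using \<beta>(1) N(1) by (simp add: M_def)
    then have "0 < (1 - \<beta> - d) * y (Suc n)" using *[OF n] by simp
    then have gt: "0 < 1 - \<beta> - d"
      using N(1)[of "Suc n"] n by (simp add: M_def zero_less_mult_iff)
    have "eventually (\<lambda>n. \<beta>\<^sup>2 / 2 / (1 - \<beta> - d) * y (\<sigma> n) \<le> y (Suc n)) sequentially"
      using ev by eventually_elim (use * gt in \<open>auto simp: field_simps\<close>)
    with gt show ?thesis unfolding S_def by simp
  qed
  \<comment> \<open>A window of positive mass is nonempty, so \<open>\<sigma> n < n\<close> and
    monotonicity keeps the ratio at most 1; \<open>\<alpha> / 2\<close> stands for any positive
    number below \<alpha>.\<close>
  have bound: "d \<le> 1" if "d \<in> S" for d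
  proof (rule ccontr)
    assume "\<not> d \<le> 1"
    have "eventually (\<lambda>n. d * y (\<sigma> n) \<le> y (Suc n) \<and> \<alpha> / 2 \<le> (\<Sum>j\<in>{\<sigma> n..<n}. p j)
        \<and> N \<le> n \<and> N \<le> \<sigma> n) sequentially"
      using that window[of "\<alpha> / 2"] \<open>0 < \<alpha>\<close> lim unfolding S_def filterlim_at_top
      by (intro eventually_conj eventually_ge_at_top) simp_all
    then obtain n where n: "d * y (\<sigma> n) \<le> y (Suc n)" "\<alpha> / 2 \<le> (\<Sum>j\<in>{\<sigma> n..<n}. p j)"
      "N \<le> n" "N \<le> \<sigma> n" unfolding eventually_sequentially by auto
    have "\<sigma> n < n" using n(2) \<open>0 < \<alpha>\<close> by (rule_tac ccontr) simp
    then have "y (Suc n) \<le> y (\<sigma> n)" using antimono n by simp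
    moreover have "y (\<sigma> n) < d * y (\<sigma> n)" using \<open>\<not> d \<le> 1\<close> N(1)[OF n(4)] by simp
    ultimately show False using n(1) by simp
  qed
  have bdd: "bdd_above S" using bound by (auto simp: bdd_above_def)
  define e where "e = Sup S"
  have "0 \<le> e" unfolding e_def by (rule cSup_upper[OF zero bdd])
  have step: "\<beta>\<^sup>2 / 2 \<le> e * (1 - \<beta> - d)" if "d \<in> S" "0 \<le> d" "0 < \<beta>" "\<beta> < \<alpha>" for d \<beta>
  proof -
    note * = improve[OF that]
    then have "\<beta>\<^sup>2 / 2 / (1 - \<beta> - d) \<le> e" unfolding e_def by (intro cSup_upper bdd) simp
    with * show ?thesis by (simp add: field_simps)
  qed
  \<comment> \<open>The window condition is available only below \<alpha>, so \<alpha> itself is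
    reached as a left limit.\<close>
  have step': "\<alpha>\<^sup>2 / 2 \<le> e * (1 - \<alpha> - d)" if d: "d \<in> S" "0 \<le> d" for d
  proof (rule tendsto_le[of "at_left \<alpha>"])
    show "((\<lambda>\<beta>. e * (1 - \<beta> - d)) \<longlongrightarrow> e * (1 - \<alpha> - d)) (at_left \<alpha>)"
      and "((\<lambda>\<beta>. \<beta>\<^sup>2 / 2) \<longlongrightarrow> \<alpha>\<^sup>2 / 2) (at_left \<alpha>)"
      by (auto intro!: tendsto_intros)
    show "eventually (\<lambda>\<beta>. \<beta>\<^sup>2 / 2 \<le> e * (1 - \<beta> - d)) (at_left \<alpha>)"
      using eventually_at_left_real[OF \<open>0 < \<alpha>\<close>]
      by eventually_elim (use step[OF d] in auto)
  qed simp
  have "0 < e"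
    using step'[OF zero] \<open>0 < \<alpha>\<close> \<open>0 \<le> e\<close> by (cases "e = 0") auto
  \<comment> \<open>\<open>S\<close> also contains negative numbers; \<open>max d 0\<close> is still
    a member and is nonnegative, as \<open>step'\<close> requires. The supremum over
    \<open>d\<close> then replaces \<open>d\<close> by \<open>e\<close>.\<close>
  have "d \<le> 1 - \<alpha> - \<alpha>\<^sup>2 / 2 / e" if "d \<in> S" for d
  proof -
    have "\<alpha>\<^sup>2 / 2 \<le> e * (1 - \<alpha> - max d 0)"
      using that zero by (intro step') (auto simp: max_def)
    then have "\<alpha>\<^sup>2 / 2 / e \<le> 1 - \<alpha> - max d 0"
      using \<open>0 < e\<close> by (simp add: pos_divide_le_eq mult.commute)
    then show ?thesis by simp
  qed
  then have "e \<le> 1 - \<alpha> - \<alpha>\<^sup>2 / 2 / e"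
    unfolding e_def using zero by (intro cSup_least) auto
  then have "\<alpha>\<^sup>2 / 2 \<le> e * (1 - \<alpha> - e)"
    using \<open>0 < e\<close> by (simp add: field_simps)
  then have "d < e" using smaller_root_le d by (meson less_le_trans)
  then obtain d' where d': "d' \<in> S" "d < d'"
    unfolding e_def using less_cSup_iff[of S d] zero bdd by auto
  from d'(1) have "eventually (\<lambda>n. d' * y (\<sigma> n) \<le> y (Suc n)) sequentially"
    by (simp add: S_def)
  with pos\<sigma> show ?thesis
  proof eventually_elim
    case (elim n)
    then have "d * y (\<sigma> n) \<le> d' * y (\<sigma> n)" using d'(2) by (intro mult_right_mono) auto
    with elim show ?case by linarith
  qed
qed

section \<open>Comparison of positive solutions with \<open>a_seq\<close>\<close>

text \<open>With the value 1 at \<open>r = 0\<close>, the clause for \<open>Suc 0\<close> becomes an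
  instance of the general recursion, so inductions on \<open>r\<close> can start at 0.\<close>

lemma a_seq_Suc:
  "a_seq m p \<tau> (Suc r) n k =
     (\<Prod>i\<in>{nat k..<nat n}. 1 - (\<Sum>l=1..m. p l i * inverse (a_seq m p \<tau> r (int i) (\<tau> l i))))"
  by (cases r) auto

lemma solution_Suc:
  assumes "is_solution m p \<tau> x"
  shows "x (int (Suc n)) = x (int n) - (\<Sum>i=1..m. p i n * x (\<tau> i n))"
proof -
  have "\<Delta> x (int n) + (\<Sum>i=1..m. p i n * x (\<tau> i n)) = 0"
    using assms by (simp add: is_solution_def)
  then show ?thesis by (simp add: \<Delta>_def add.commute)
qed

text \<open>Positivity of \<open>a\<^sub>r(n,k)\<close> is implicit in the conclusion, as \<open>x n\<close> and \<open>x k\<close> are positive.\<close>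

lemma solution_le_a_seq:
  fixes x :: "int \<Rightarrow> real"
  assumes sol: "is_solution m p \<tau> x"
    and p: "\<And>i n. i \<in> {1..m} \<Longrightarrow> 0 \<le> p i n"
    and before: "\<And>i n. i \<in> {1..m} \<Longrightarrow> \<tau> i n \<le> int n"
    and lim: "\<And>i. i \<in> {1..m} \<Longrightarrow> filterlim (\<tau> i) at_top sequentially"
    and pos: "eventually (\<lambda>n. 0 < x n) at_top"
  shows "\<exists>N. \<forall>k n. N \<le> k \<longrightarrow> k \<le> n \<longrightarrow> 0 < x n \<and> x n \<le> a_seq m p \<tau> r n k * x k"
proof -
  have tau_ge: "\<exists>M. \<forall>n\<ge>M. \<forall>i\<in>{1..m}. N \<le> \<tau> i n" for N
    using lim eventually_ball_finite[of "{1..m}" "\<lambda>n i. N \<le> \<tau> i n" sequentially]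
    by (simp add: filterlim_at_top eventually_sequentially)
  obtain N0 where N0: "\<And>n. N0 \<le> n \<Longrightarrow> 0 < x n"
    using pos unfolding eventually_at_top_linorder by auto
  \<comment> \<open>This is the case \<open>r = 0\<close>: the comparison with the constant 1 is
    eventual monotonicity.\<close>
  have base: "\<exists>N. \<forall>k n. N \<le> k \<longrightarrow> k \<le> n \<longrightarrow> x n \<le> x k"
  proof -
    obtain M where M: "\<And>n i. M \<le> n \<Longrightarrow> i \<in> {1..m} \<Longrightarrow> N0 \<le> \<tau> i n"
      using tau_ge[of N0] by blast
    have "x n \<le> x k" if "int M \<le> k" "k \<le> n" for k n
      using that(2)
    proof (induction n rule: int_ge_induct)
      case (step n)
      have n: "M \<le> nat n" "n = int (nat n)" using step that(1) by auto
      have "0 \<le> (\<Sum>i=1..m. p i (nat n) * x (\<tau> i (nat n)))"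
        using p M[OF n(1)] N0 by (intro sum_nonneg mult_nonneg_nonneg) (auto intro: less_imp_le)
      then show ?case
        using solution_Suc[OF sol, of "nat n"] step n by (simp add: add.commute)
    qed simp
    then show ?thesis by blast
  qed
  have "\<exists>N. \<forall>k n. N \<le> k \<longrightarrow> k \<le> n \<longrightarrow> x n \<le> a_seq m p \<tau> r n k * x k"
  proof (induction r)
    case 0
    then show ?case using base by simp
  next
    case (Suc r)
    then obtain N where N: "\<And>k n. N \<le> k \<Longrightarrow> k \<le> n \<Longrightarrow> x n \<le> a_seq m p \<tau> r n k * x k"
      by blast
    obtain M0 where M0: "\<And>n i. M0 \<le> n \<Longrightarrow> i \<in> {1..m} \<Longrightarrow> max N N0 \<le> \<tau> i n"
      using tau_ge[of "max N N0"] by blast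
    define M where "M = max M0 (nat N0)"
    define f where "f i = 1 - (\<Sum>l=1..m. p l i * inverse (a_seq m p \<tau> r (int i) (\<tau> l i)))" for i
    \<comment> \<open>One step of the Gronwall argument: the induction hypothesis on the stretch
      from \<open>\<tau> l i\<close> to \<open>i\<close> bounds the delayed value below by
      \<open>x (int i)\<close> over \<open>a_seq\<close>.\<close>
    have f: "x (int (Suc i)) \<le> f i * x (int i)" if i: "M \<le> i" for i
    proof -
      have "x (int i) * (p l i * inverse (a_seq m p \<tau> r (int i) (\<tau> l i))) \<le> p l i * x (\<tau> l i)"
        if l: "l \<in> {1..m}" for l
      proof -
        let ?a = "a_seq m p \<tau> r (int i) (\<tau> l i)"
        have t: "N \<le> \<tau> l i" "N0 \<le> \<tau> l i" using M0[of i l] i l by (auto simp: M_def)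
        have "x (int i) \<le> ?a * x (\<tau> l i)" using N t before l by simp
        moreover have "0 < x (int i)" "0 < x (\<tau> l i)"
          using N0 t i by (auto simp: M_def)
        ultimately have "0 < ?a"
          by (meson less_le_trans zero_less_mult_pos2)
        then have "x (int i) * inverse ?a \<le> x (\<tau> l i)"
          using \<open>x (int i) \<le> ?a * x (\<tau> l i)\<close> by (simp add: field_simps)
        then have "p l i * (x (int i) * inverse ?a) \<le> p l i * x (\<tau> l i)"
          using p[OF l] by (rule mult_left_mono)
        then show ?thesis by (simp add: mult_ac)
      qed
      then have "x (int i) * (\<Sum>l=1..m. p l i * inverse (a_seq m p \<tau> r (int i) (\<tau> l i)))
          \<le> (\<Sum>l=1..m. p l i * x (\<tau> l i))"
        unfolding sum_distrib_left by (intro sum_mono) auto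
      then show ?thesis
        unfolding solution_Suc[OF sol] f_def by (simp add: algebra_simps)
    qed
    \<comment> \<open>Needed to multiply the one-step bounds; it is forced by the positivity of
      consecutive values of \<open>x\<close>.\<close>
    have fpos: "0 < f i" if "M \<le> i" for i
    proof -
      have "0 < x (int (Suc i))" "0 < x (int i)" using N0 that by (auto simp: M_def)
      then show ?thesis using f[OF that] by (meson less_le_trans zero_less_mult_pos2)
    qed
    have prod: "x (int n) \<le> (\<Prod>i\<in>{k..<n}. f i) * x (int k)" if "M \<le> k" "k \<le> n" for k n
      using that(2)
    proof (induction n rule: dec_induct)
      case (step n)
      have n: "M \<le> n" using step that(1) by simp
      have "x (int (Suc n)) \<le> f n * x (int n)" by (rule f[OF n])
      also have "\<dots> \<le> f n * ((\<Prod>i\<in>{k..<n}. f i) * x (int k))"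
        using step fpos[OF n] by (intro mult_left_mono) auto
      finally show ?case using step by (simp add: mult_ac)
    qed simp
    have "x n \<le> a_seq m p \<tau> (Suc r) n k * x k" if "int M \<le> k" "k \<le> n" for k n
      using prod[of "nat k" "nat n"] that by (simp add: a_seq_Suc f_def)
    then show ?case by blast
  qed
  then obtain N where "\<And>k n. N \<le> k \<Longrightarrow> k \<le> n \<Longrightarrow> x n \<le> a_seq m p \<tau> r n k * x k"
    by blast
  then show ?thesis using N0 by (intro exI[of _ "max N N0"]) auto
qed

section \<open>Running maxima of the delays and the criterion\<close>

lemma \<tau>_le_\<phi>i: "s \<le> n \<Longrightarrow> \<tau> i s \<le> \<phi>i \<tau> i n"
  unfolding \<phi>i_def by (intro Max_ge) auto

lemma mono_\<phi>i: "mono (\<phi>i \<tau> i)"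
  unfolding \<phi>i_def by (intro monoI Max_mono) auto

lemma \<phi>i_le_\<phi>: "i \<in> {1..m} \<Longrightarrow> \<phi>i \<tau> i n \<le> \<phi> m \<tau> n"
  unfolding \<phi>_def by (intro Max_ge) auto

lemma \<phi>_less:
  assumes "1 \<le> m" "\<And>i n. i \<in> {1..m} \<Longrightarrow> \<tau> i n \<le> int n - 1"
  shows "\<phi> m \<tau> n < int n"
proof -
  have "\<tau> i s < int n" if "i \<in> {1..m}" "s \<le> n" for i s
    using assms(2)[OF that(1), of s] that(2) by simp
  then show ?thesis
    using assms(1) unfolding \<phi>_def \<phi>i_def by (auto)
qed

text \<open>For \<open>j \<le> n\<close> the argument \<open>\<tau> i j\<close> is at most
  \<open>\<phi> m \<tau> n\<close>, so the comparison bounds \<open>x (\<tau> i j)\<close> by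
  \<open>x (\<phi> m \<tau> n)\<close>. Summing the equation telescopes, and the ratio bound
  controls the remaining \<open>x (int (Suc n))\<close>.\<close>

lemma criterion_sum_le_eventually_positive:
  fixes x :: "int \<Rightarrow> real"
  assumes m: "1 \<le> m"
    and p: "\<And>i n. i \<in> {1..m} \<Longrightarrow> 0 \<le> p i n"
    and \<tau>: "\<And>i n. i \<in> {1..m} \<Longrightarrow> \<tau> i n \<le> int n - 1"
    and lim: "\<And>i. i \<in> {1..m} \<Longrightarrow> filterlim (\<tau> i) at_top sequentially"
    and \<alpha>: "ereal \<alpha> = min_\<alpha>i m p \<tau>" "0 < \<alpha>"
    and sol: "is_solution m p \<tau> x"
    and pos: "eventually (\<lambda>n. 0 < x n) at_top"
    and d: "d < (1 - \<alpha> - sqrt (1 - 2 * \<alpha> - \<alpha>\<^sup>2)) / 2"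
  shows "eventually (\<lambda>n. (\<Sum>j\<in>{nat (\<phi> m \<tau> n)..n}. \<Sum>i=1..m.
           p i j * inverse (a_seq m p \<tau> r (\<phi> m \<tau> n) (\<tau> i j))) \<le> 1 - d) sequentially"
proof -
  have \<tau>': "\<tau> i n \<le> int n" if "i \<in> {1..m}" for i n
    using \<tau>[OF that, of n] by simp
  obtain N0 where N0: "\<And>k n. N0 \<le> k \<Longrightarrow> k \<le> n \<Longrightarrow> 0 < x n \<and> x n \<le> a_seq m p \<tau> 0 n k * x k"
    using solution_le_a_seq[OF sol p \<tau>' lim pos, of 0] by blast
  have xpos: "0 < x n" if "N0 \<le> n" for n using N0[OF that order_refl] by simp
  have xanti: "x n \<le> x k" if "N0 \<le> k" "k \<le> n" for k n using N0[OF that] by simp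
  obtain N1 where N1: "\<And>k n. N1 \<le> k \<Longrightarrow> k \<le> n \<Longrightarrow> x n \<le> a_seq m p \<tau> r n k * x k"
    using solution_le_a_seq[OF sol p \<tau>' lim pos, of r] by blast
  have one: "1 \<in> {1..m}" using m by simp
  \<comment> \<open>The single delay is taken from the index 1, whose lower limit is at least
    \<alpha>. The cut-off by \<open>nat\<close> disappears for large \<open>n\<close>.\<close>
  define \<sigma> where "\<sigma> n = nat (\<phi>i \<tau> 1 n)" for n
  have ev\<tau>: "eventually (\<lambda>n. \<forall>i\<in>{1..m}. N \<le> \<tau> i n) sequentially" for N
    using lim by (auto intro!: eventually_ball_finite simp: filterlim_at_top)
  have ev\<phi>i: "eventually (\<lambda>n. N \<le> \<phi>i \<tau> 1 n) sequentially" for N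
    using ev\<tau>[of N]
  proof eventually_elim
    case (elim n)
    then show ?case using one \<tau>_le_\<phi>i[of n n \<tau> 1] by force
  qed
  have "mono \<sigma>"
    using mono_\<phi>i[of \<tau> 1] unfolding \<sigma>_def mono_def by (auto intro: nat_mono)
  have lim\<sigma>: "filterlim \<sigma> at_top sequentially"
    unfolding filterlim_at_top
  proof
    fix Z
    show "eventually (\<lambda>n. Z \<le> \<sigma> n) sequentially"
      using ev\<phi>i[of "int Z"] by eventually_elim (simp add: \<sigma>_def)
  qed
  have ratio: "eventually (\<lambda>n. d * x (int (\<sigma> n)) \<le> x (int (Suc n))) sequentially"
  proof (rule delay_ratio_lower_bound[where y = "\<lambda>n. x (int n)" and p = "p 1" and \<alpha> = \<alpha>])
    show "eventually (\<lambda>n. 0 < x (int n)) sequentially"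
      using eventually_ge_at_top[of "nat N0"] by eventually_elim (auto intro: xpos)
    \<comment> \<open>The other terms are nonnegative and are dropped; passing from
      \<open>\<tau> 1 n\<close> to the larger \<open>\<sigma> n\<close> decreases the value of
      \<open>x\<close>.\<close>
    show "eventually (\<lambda>n. x (int (Suc n)) \<le> x (int n) - p 1 n * x (int (\<sigma> n))) sequentially"
      using ev\<tau>[of "max 0 N0"]
    proof eventually_elim
      case (elim n)
      have t: "N0 \<le> \<tau> i n" "0 \<le> \<tau> i n" if "i \<in> {1..m}" for i using elim that by auto
      have "\<tau> 1 n \<le> int (\<sigma> n)"
        using \<tau>_le_\<phi>i[of n n \<tau> 1] t(2)[OF one] by (simp add: \<sigma>_def)
      have nonneg: "0 \<le> p i n * x (\<tau> i n)" if "i \<in> {1..m}" for i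
        using p[OF that, of n] xpos[OF t(1)[OF that]] by simp
      have "x (int (\<sigma> n)) \<le> x (\<tau> 1 n)"
        using \<open>\<tau> 1 n \<le> int (\<sigma> n)\<close> t[OF one] by (intro xanti)
      then have "p 1 n * x (int (\<sigma> n)) \<le> p 1 n * x (\<tau> 1 n)"
        using p[OF one] by (intro mult_left_mono)
      also have "\<dots> \<le> (\<Sum>i=1..m. p i n * x (\<tau> i n))"
        using one nonneg by (intro member_le_sum) auto
      finally show ?case using solution_Suc[OF sol, of n] by simp
    qed
    show "eventually (\<lambda>n. \<beta> \<le> (\<Sum>j\<in>{\<sigma> n..<n}. p 1 j)) sequentially" if "\<beta> < \<alpha>" for \<beta>
    proof -
      have "min_\<alpha>i m p \<tau> \<le> \<alpha>i p \<tau> 1"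
        unfolding min_\<alpha>i_def using one by (intro Min_le) auto
      then have "ereal \<beta> < liminf (\<lambda>n. ereal (\<Sum>j\<in>{\<sigma> n..<n}. p 1 j))"
        using \<alpha>(1) that unfolding \<alpha>i_def \<sigma>_def
        by (metis less_ereal.simps(1) order_less_le_trans)
      from less_LiminfD[OF this] show ?thesis
        by eventually_elim (simp add: less_imp_le)
    qed
  qed (use p one \<open>mono \<sigma>\<close> lim\<sigma> \<open>0 < \<alpha>\<close> d in auto)
  obtain M where M: "\<And>n i. M \<le> n \<Longrightarrow> i \<in> {1..m} \<Longrightarrow> max N0 N1 \<le> \<tau> i n"
    using ev\<tau>[of "max N0 N1"] unfolding eventually_sequentially by blast
  show ?thesis
    using ratio ev\<phi>i[of "max (int M) (max 0 N0)"]
  proof eventually_elim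
    case (elim n)
    define k where "k = nat (\<phi> m \<tau> n)"
    have le: "\<phi>i \<tau> 1 n \<le> \<phi> m \<tau> n" by (rule \<phi>i_le_\<phi>[OF one])
    have k: "int k = \<phi> m \<tau> n" "M \<le> k" "N0 \<le> int k" "int (\<sigma> n) \<le> int k"
      "N0 \<le> int (\<sigma> n)" using elim le by (auto simp: k_def \<sigma>_def)
    have "int k < int n" unfolding k(1) by (rule \<phi>_less[OF m \<tau>])
    have "0 < x (int k)" using k by (intro xpos)
    have summand: "x (int k) * (p i j * inverse (a_seq m p \<tau> r (int k) (\<tau> i j))) \<le> p i j * x (\<tau> i j)"
      if i: "i \<in> {1..m}" and j: "k \<le> j" "j \<le> n" for i j
    proof -
      let ?a = "a_seq m p \<tau> r (int k) (\<tau> i j)"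
      have t: "N0 \<le> \<tau> i j" "N1 \<le> \<tau> i j" using M[of j i] i j k by auto
      have "\<tau> i j \<le> int k"
        using \<tau>_le_\<phi>i[OF j(2), of \<tau> i] \<phi>i_le_\<phi>[OF i, of \<tau> n] k(1) by simp
      then have le: "x (int k) \<le> ?a * x (\<tau> i j)" using N1 t by simp
      then have "0 < ?a * x (\<tau> i j)" using \<open>0 < x (int k)\<close> by simp
      then have "0 < ?a" using xpos[OF t(1)] by (rule zero_less_mult_pos2)
      then have "x (int k) * inverse ?a \<le> x (\<tau> i j)"
        using le by (simp add: field_simps)
      then have "p i j * (x (int k) * inverse ?a) \<le> p i j * x (\<tau> i j)"
        using p[OF i] by (rule mult_left_mono)
      then show ?thesis by (simp add: mult_ac)
    qed
    have "(\<Sum>j\<in>{k..<Suc n}. x (int k) * (\<Sum>i=1..m. p i j * inverse (a_seq m p \<tau> r (int k) (\<tau> i j))))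
        \<le> x (int k) - x (int (Suc n))"
    proof (rule sum_decrements)
      fix j assume "k \<le> j" "j < Suc n"
      then show "x (int k) * (\<Sum>i=1..m. p i j * inverse (a_seq m p \<tau> r (int k) (\<tau> i j)))
          \<le> x (int j) - x (int (Suc j))"
        unfolding solution_Suc[OF sol] sum_distrib_left by (auto intro!: sum_mono summand)
    qed (use \<open>int k < int n\<close> in simp)
    also have "\<dots> \<le> x (int k) - d * x (int k)"
    \<comment> \<open>For negative \<open>d\<close> monotonicity would act in the wrong direction,
      but then positivity of \<open>x (int (Suc n))\<close> suffices.\<close>
    proof (cases "0 \<le> d")
      case True
      then have "d * x (int k) \<le> d * x (int (\<sigma> n))"
        using k by (intro mult_left_mono xanti)
      then show ?thesis using elim by simp
    next
      case False
      then have "d * x (int k) \<le> 0" using \<open>0 < x (int k)\<close> by (simp add: mult_le_0_iff)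
      moreover have "0 < x (int (Suc n))" using k \<open>int k < int n\<close> by (intro xpos) simp
      ultimately show ?thesis by simp
    qed
    finally have "x (int k) * (\<Sum>j\<in>{k..n}. \<Sum>i=1..m. p i j * inverse (a_seq m p \<tau> r (int k) (\<tau> i j)))
        \<le> x (int k) * (1 - d)"
      by (simp add: sum_distrib_left atLeastLessThanSuc_atLeastAtMost algebra_simps)
    then show ?case
      using \<open>0 < x (int k)\<close> k(1) by (simp add: k_def)
  qed
qed

theorem theorem2p5:
  fixes m :: nat
    and p :: "nat \<Rightarrow> nat \<Rightarrow> real"
    and \<tau> :: "nat \<Rightarrow> nat \<Rightarrow> int"
    and \<alpha> :: real
    and r :: nat
  assumes "m \<ge> 1"
    and "\<And>i n. i \<in> {1..m} \<Longrightarrow> p i n \<ge> 0"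
    and "\<And>n. (\<Sum>i=1..m. p i n) < 1"
    and "\<And>i n. i \<in> {1..m} \<Longrightarrow> \<tau> i n \<le> int n - 1"
    and "\<And>i. i \<in> {1..m} \<Longrightarrow> filterlim (\<tau> i) at_top sequentially"
    and "ereal \<alpha> = min_\<alpha>i m p \<tau>"
    and "0 < \<alpha>" and "\<alpha> \<le> 1 / exp 1"
    and "r \<ge> 1"
    and "limsup (\<lambda>n. ereal (\<Sum>j\<in>{nat (\<phi> m \<tau> n)..n}. \<Sum>i=1..m.
           p i j * inverse (a_seq m p \<tau> r (\<phi> m \<tau> n) (\<tau> i j))))
         > ereal (1 - (1 - \<alpha> - sqrt (1 - 2 * \<alpha> - \<alpha>\<^sup>2)) / 2)"
  shows "\<forall>x. is_solution m p \<tau> x \<longrightarrow> oscillatory x"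
proof -
  let ?D = "(1 - \<alpha> - sqrt (1 - 2 * \<alpha> - \<alpha>\<^sup>2)) / 2"
  let ?s = "\<lambda>n. \<Sum>j\<in>{nat (\<phi> m \<tau> n)..n}. \<Sum>i=1..m.
    p i j * inverse (a_seq m p \<tau> r (\<phi> m \<tau> n) (\<tau> i j))"
  have nonpos: False if sol: "is_solution m p \<tau> x" and pos: "\<forall>\<^sub>F n in at_top. x n > 0" for x
  proof -
    \<comment> \<open>The lemma covers only bounds strictly below \<open>?D\<close>, so the strict
      gap in the criterion is split by \<open>c\<close> and the lemma is applied with
      \<open>d = 1 - c\<close>.\<close>
    obtain c where c: "ereal (1 - ?D) < ereal c" "ereal c < limsup (\<lambda>n. ereal (?s n))"
      using ereal_dense2[OF assms(10)] by blast
    have "1 - c < ?D" using c(1) by (simp only: less_ereal.simps)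
    then have "eventually (\<lambda>n. ?s n \<le> 1 - (1 - c)) sequentially"
      by (intro criterion_sum_le_eventually_positive[where x = x and \<alpha> = \<alpha>] assms sol pos)
    then have "limsup (\<lambda>n. ereal (?s n)) \<le> ereal c"
      by (intro Limsup_bounded) (auto elim: eventually_mono)
    with c(2) show False by simp
  qed
  \<comment> \<open>By linearity, negation reduces eventually negative solutions to eventually
    positive ones.\<close>
  have "is_solution m p \<tau> (\<lambda>n. - x n)" if "is_solution m p \<tau> x" for x
  proof -
    have "\<Delta> (\<lambda>n. - x n) n = - \<Delta> x n" for n by (simp add: \<Delta>_def)
    moreover have "- a - b = 0 \<longleftrightarrow> a + b = 0" for a b :: real by linarith
    ultimately show ?thesis using that by (simp add: is_solution_def sum_negf)
  qed
  then show ?thesis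
    using nonpos nonpos[of "\<lambda>n. - x n" for x] unfolding oscillatory_def by auto
qed

end
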